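(* Let $\{A,B\}=\partial_iA\,\omega^{ij}\,\partial_jB$ be a degenerate Poisson bracket on a manifold $\mathbb{M}$ with local coordinates $z^i$. Let $\Phi^\alpha(z)$ be functionally independent functions such that $\triangle^{\alpha\beta}=\{\Phi^\alpha,\Phi^\beta\}$ satisfies $\det\triangle^{\alpha\beta}\neq0$ on the surface $\{\Phi^\alpha=0\}$, and let $\tilde\triangle_{\alpha\beta}$ be the inverse matrix of $\triangle^{\alpha\beta}$. Then the Dirac bracket $$\{A,B\}_D=\{A,B\}-\{A,\Phi^\alpha\}\,\tilde\triangle_{\alpha\beta}\,\{\Phi^\beta,B\}$$ satisfies the Jacobi identity $\{A,\{B,C\}_D\}_D+\mathrm{cycle}(A,B,C)=0$ for all functions $A,B,C$.
   Context: All objects are smooth, and all statements are local; the Dirac bracket is considered in a neighbourhood of $\{\Phi^\alpha=0\}$ where $\triangle^{\alpha\beta}$ is invertible. Repeated indices are summed; $\mathrm{cycle}$ denotes the two remaining cyclic permutations. A Poisson tensor is a contravariant tensor $\omega^{ij}(z)$ with $\omega^{ij}=-\omega^{ji}$ and $\omega^{ip}\partial_p\omega^{jk}+\mathrm{cycle}(i,j,k)=0$, and $\{A,B\}=\partial_iA\,\omega^{ij}\,\partial_jB$ is its Poisson bracket; the bracket is degenerate when $\det\omega=0$. The standing setting for the degenerate case: the Poisson tensor has (locally constant) rank $n$ on a manifold of dimension $m+n$, and the number of functions $\Phi^\alpha$ is less than $n$. Functions $\Phi^1,\dots,\Phi^p$ are functionally independent if $\operatorname{rank}(\partial_i\Phi^\alpha)=p$.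 *)

theory Defs
  imports "HOL-Analysis.Analysis"
begin

text \<open>
  The manifold is represented by a coordinate chart, i.e. an open subset of \<open>real ^ 'i\<close>, and
  tensors by their components in the coordinates \<open>z $ i\<close>.
\<close>

definition partial_deriv :: "'i::finite \<Rightarrow> (real ^ 'i \<Rightarrow> real) \<Rightarrow> real ^ 'i \<Rightarrow> real" where
  "partial_deriv i f z = frechet_derivative f (at z) (axis i 1)"

text \<open>
  For open \<open>U\<close> this is the usual class of \<open>k\<close> times continuously differentiable functions: the
  Frechet derivative occurring in \<^const>\<open>partial_deriv\<close> is then the genuine one at every point of
  \<open>U\<close>, and it depends only on the values of \<open>f\<close> near that point.
\<close>

primrec Ck_on :: "nat \<Rightarrow> (real ^ 'i) set \<Rightarrow> (real ^ 'i::finite \<Rightarrow> real) \<Rightarrow> bool" where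
  "Ck_on 0 = (\<lambda>U f. continuous_on U f)"
| "Ck_on (Suc k) = (\<lambda>U f. f differentiable_on U \<and> (\<forall>i. Ck_on k U (partial_deriv i f)))"

definition smooth_fun_on :: "(real ^ 'i::finite) set \<Rightarrow> (real ^ 'i \<Rightarrow> real) \<Rightarrow> bool" where
  "smooth_fun_on U f \<longleftrightarrow> (\<forall>k. Ck_on k U f)"

definition poisson_tensor_on ::
    "(real ^ 'i::finite) set \<Rightarrow> (real ^ 'i \<Rightarrow> real ^ 'i ^ 'i) \<Rightarrow> bool" where
  "poisson_tensor_on U \<omega> \<longleftrightarrow>
     (\<forall>i j. smooth_fun_on U (\<lambda>z. \<omega> z $ i $ j)) \<and>
     (\<forall>z\<in>U. \<forall>i j. \<omega> z $ i $ j = - (\<omega> z $ j $ i)) \<and>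
     (\<forall>z\<in>U. \<forall>i j k.
        (\<Sum>p\<in>UNIV. \<omega> z $ i $ p * partial_deriv p (\<lambda>y. \<omega> y $ j $ k) z) +
        (\<Sum>p\<in>UNIV. \<omega> z $ j $ p * partial_deriv p (\<lambda>y. \<omega> y $ k $ i) z) +
        (\<Sum>p\<in>UNIV. \<omega> z $ k $ p * partial_deriv p (\<lambda>y. \<omega> y $ i $ j) z) = 0)"

definition poisson_bracket ::
    "(real ^ 'i::finite \<Rightarrow> real ^ 'i ^ 'i) \<Rightarrow> (real ^ 'i \<Rightarrow> real) \<Rightarrow> (real ^ 'i \<Rightarrow> real) \<Rightarrow>
     real ^ 'i \<Rightarrow> real" where
  "poisson_bracket \<omega> A B z =
     (\<Sum>i\<in>UNIV. \<Sum>j\<in>UNIV. partial_deriv i A z * \<omega> z $ i $ j * partial_deriv j B z)"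

definition degenerate_on :: "(real ^ 'i::finite) set \<Rightarrow> (real ^ 'i \<Rightarrow> real ^ 'i ^ 'i) \<Rightarrow> bool" where
  "degenerate_on U \<omega> \<longleftrightarrow> (\<forall>z\<in>U. det (\<omega> z) = 0)"

definition functionally_independent_on ::
    "(real ^ 'i::finite) set \<Rightarrow> ('a::finite \<Rightarrow> real ^ 'i \<Rightarrow> real) \<Rightarrow> bool" where
  "functionally_independent_on U \<Phi> \<longleftrightarrow>
     (\<forall>z\<in>U. rank ((\<chi> \<alpha> i. partial_deriv i (\<Phi> \<alpha>) z) :: real ^ 'i ^ 'a) = CARD('a))"

definition constraint_surface ::
    "(real ^ 'i::finite) set \<Rightarrow> ('a::finite \<Rightarrow> real ^ 'i \<Rightarrow> real) \<Rightarrow> (real ^ 'i) set" where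
  "constraint_surface U \<Phi> = {z \<in> U. \<forall>\<alpha>. \<Phi> \<alpha> z = 0}"

definition constraint_matrix ::
    "(real ^ 'i::finite \<Rightarrow> real ^ 'i ^ 'i) \<Rightarrow> ('a::finite \<Rightarrow> real ^ 'i \<Rightarrow> real) \<Rightarrow>
     real ^ 'i \<Rightarrow> real ^ 'a ^ 'a" where
  "constraint_matrix \<omega> \<Phi> z = (\<chi> \<alpha> \<beta>. poisson_bracket \<omega> (\<Phi> \<alpha>) (\<Phi> \<beta>) z)"

definition dirac_domain ::
    "(real ^ 'i::finite) set \<Rightarrow> (real ^ 'i \<Rightarrow> real ^ 'i ^ 'i) \<Rightarrow>
     ('a::finite \<Rightarrow> real ^ 'i \<Rightarrow> real) \<Rightarrow> (real ^ 'i) set" where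
  "dirac_domain U \<omega> \<Phi> = {z \<in> U. det (constraint_matrix \<omega> \<Phi> z) \<noteq> 0}"

text \<open>
  \<^const>\<open>matrix_inv\<close> is unspecified at singular matrices, so the Dirac bracket is meaningful only on
  \<^const>\<open>dirac_domain\<close>.
\<close>

definition dirac_bracket ::
    "(real ^ 'i::finite \<Rightarrow> real ^ 'i ^ 'i) \<Rightarrow> ('a::finite \<Rightarrow> real ^ 'i \<Rightarrow> real) \<Rightarrow>
     (real ^ 'i \<Rightarrow> real) \<Rightarrow> (real ^ 'i \<Rightarrow> real) \<Rightarrow> real ^ 'i \<Rightarrow> real" where
  "dirac_bracket \<omega> \<Phi> A B z =
     poisson_bracket \<omega> A B z -
     (\<Sum>\<alpha>\<in>UNIV. \<Sum>\<beta>\<in>UNIV. poisson_bracket \<omega> A (\<Phi> \<alpha>) z *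
        matrix_inv (constraint_matrix \<omega> \<Phi> z) $ \<alpha> $ \<beta> * poisson_bracket \<omega> (\<Phi> \<beta>) B z)"

end

(* At a point z the shifted functions A' = A - sum c_a Phi_a, with constants c_a chosen so that
   {A',Phi_b}(z) = 0, have the same Dirac brackets as A, because the Phi_a are Casimir functions of
   the Dirac bracket. For shifted functions the correction term in {B',C'}_D is a sum of products
   with two factors vanishing at z, so it has zero differential there; hence the Dirac Jacobiator
   at z equals the Poisson Jacobiator of A', B', C'. *)
theory Submission
  imports Defs
begin

text \<open>The constants c_a belong to the point z, so {A',Phi_b} vanishes at z and in general
  nowhere else. This is enough because the outer bracket takes just one derivative of the inner one,
  at z. Being Casimir is needed on more than a point: replacing B, C by B', C' inside the outer
  bracket must not change {B,C}_D on a whole neighbourhood of z, and the Casimir property indeed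
  holds wherever the constraint matrix is invertible, on or off the constraint surface. The gain is
  that the derivative of the inverse matrix is never computed. Its entries only have to be
  differentiable, which Cramer's rule gives, and smooth functions only have to be closed under
  subtracting constant multiples of each other. The Jacobi identity of the Poisson bracket itself is
  derived from the tensor identity for \<open>\<omega>\<close>. There the second derivatives of A,
  B, C cancel by symmetry of mixed partial derivatives, proved below from continuity of the second
  partial derivatives.\<close>

section \<open>Rules for partial derivatives\<close>

lemma partial_deriv_eqI:
  assumes "(f has_derivative f') (at z)"
  shows "partial_deriv i f z = f' (axis i 1)"
  using frechet_derivative_at[OF assms] by (simp add: partial_deriv_def)

text \<open>\<open>frechet_derivative\<close> is a choice among all candidate derivatives. Functions
  that agree near \<open>z\<close> have the same candidates, so the choices coincide even if there
  is no derivative at all.\<close>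

lemma partial_deriv_cong_open:
  assumes "open W" "z \<in> W" "\<And>y. y \<in> W \<Longrightarrow> f y = g y"
  shows "partial_deriv i f z = partial_deriv i g z"
proof -
  have "(f has_derivative f') (at z) \<longleftrightarrow> (g has_derivative f') (at z)" for f'
    using has_derivative_transform_within_open[OF _ assms(1,2), of f f' UNIV g]
      has_derivative_transform_within_open[OF _ assms(1,2), of g f' UNIV f] assms(3) by auto
  then show ?thesis
    by (simp add: partial_deriv_def frechet_derivative_def)
qed

lemma partial_deriv_mult:
  assumes "f differentiable at z" "g differentiable at z"
  shows "partial_deriv i (\<lambda>y. f y * g y) z = f z * partial_deriv i g z + partial_deriv i f z * g z"
proof -
  have "((\<lambda>y. f y * g y) has_derivative
      (\<lambda>h. f z * frechet_derivative g (at z) h + frechet_derivative f (at z) h * g z)) (at z)"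
    by (intro has_derivative_mult assms[unfolded frechet_derivative_works])
  from partial_deriv_eqI[OF this] show ?thesis by (simp add: partial_deriv_def)
qed

lemma partial_deriv_diff:
  assumes "f differentiable at z" "g differentiable at z"
  shows "partial_deriv i (\<lambda>y. f y - g y) z = partial_deriv i f z - partial_deriv i g z"
  using partial_deriv_eqI[OF has_derivative_diff[OF assms[unfolded frechet_derivative_works]]]
  by (simp add: partial_deriv_def)

lemma partial_deriv_sum:
  assumes "\<And>a. a \<in> S \<Longrightarrow> f a differentiable at z"
  shows "partial_deriv i (\<lambda>y. \<Sum>a\<in>S. f a y) z = (\<Sum>a\<in>S. partial_deriv i (f a) z)"
  using partial_deriv_eqI[OF has_derivative_sum[of S f "\<lambda>a. frechet_derivative (f a) (at z)" "at z"]]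
    assms[unfolded frechet_derivative_works]
  by (simp add: partial_deriv_def)

lemma partial_deriv_cmult:
  assumes "f differentiable at z"
  shows "partial_deriv i (\<lambda>y. c * f y) z = c * partial_deriv i f z"
  using partial_deriv_eqI[OF has_derivative_mult_right[OF assms[unfolded frechet_derivative_works]]]
  by (simp add: partial_deriv_def)

section \<open>Closure properties of smooth functions\<close>

text \<open>The recursion of \<open>Ck_on\<close> passes to \<open>partial_deriv i f\<close> as a
  function on the whole space, whereas the differentiation rules describe it only at points of
  \<open>W\<close>. With this congruence an identity valid on \<open>W\<close> can be substituted;
  openness of \<open>W\<close> carries it over to all higher derivatives.\<close>

lemma Ck_on_cong:
  assumes "open W" "\<And>y. y \<in> W \<Longrightarrow> f y = g y"
  shows "Ck_on k W f \<longleftrightarrow> Ck_on k W g"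
  using assms(2)
proof (induction k arbitrary: f g)
  case 0
  then show ?case using continuous_on_cong[OF refl, of W f g] by auto
next
  case (Suc k)
  have "f differentiable_on W \<longleftrightarrow> g differentiable_on W"
    using Suc.prems unfolding differentiable_on_def
    by (metis differentiable_transform_within[OF _ zero_less_one])
  moreover have "Ck_on k W (partial_deriv i f) \<longleftrightarrow> Ck_on k W (partial_deriv i g)" for i
    using partial_deriv_cong_open[OF assms(1) _ Suc.prems] by (intro Suc.IH) auto
  ultimately show ?case by simp
qed

lemma Ck_on_subset:
  assumes "Ck_on k U f" "W \<subseteq> U"
  shows "Ck_on k W f"
  using assms
  by (induction k arbitrary: f) (auto intro: continuous_on_subset differentiable_on_subset)

lemma smooth_fun_on_subset: "smooth_fun_on U f \<Longrightarrow> W \<subseteq> U \<Longrightarrow> smooth_fun_on W f"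
  by (auto simp: smooth_fun_on_def intro: Ck_on_subset)

text \<open>Partial derivatives of such a combination are combinations of the same form with the
  same constant \<open>c\<close>, so the induction closes. Iterating it yields the shifted
  functions.\<close>

lemma Ck_on_diff_cmult:
  assumes "open W" "Ck_on k W f" "Ck_on k W g"
  shows "Ck_on k W (\<lambda>y. f y - c * g y)"
  using assms(2,3)
proof (induction k arbitrary: f g)
  case 0
  then show ?case by (simp add: continuous_on_diff continuous_on_mult_left)
next
  case (Suc k)
  have d: "f differentiable at y" "g differentiable at y" if "y \<in> W" for y
    using Suc.prems that differentiable_on_eq_differentiable_at[OF \<open>open W\<close>] by auto
  have "partial_deriv i (\<lambda>y. f y - c * g y) y = partial_deriv i f y - c * partial_deriv i g y"
    if "y \<in> W" for i y
    using d[OF that] by (simp add: partial_deriv_diff partial_deriv_cmult)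
  then have "Ck_on k W (partial_deriv i (\<lambda>y. f y - c * g y))" for i
    using Suc.prems by (subst Ck_on_cong[OF \<open>open W\<close>]) (auto intro: Suc.IH)
  moreover have "(\<lambda>y. f y - c * g y) differentiable_on W"
    using Suc.prems
    by (intro differentiable_on_diff differentiable_on_mult differentiable_on_const) auto
  ultimately show ?case by simp
qed

lemma smooth_fun_on_diff_sum:
  assumes "open W" "smooth_fun_on W f" "\<And>a. a \<in> S \<Longrightarrow> smooth_fun_on W (g a)" "finite S"
  shows "smooth_fun_on W (\<lambda>y. f y - (\<Sum>a\<in>S. c a * g a y))"
  using assms(4,3)
proof (induction S)
  case empty
  then show ?case using assms(2) by simp
next
  case (insert a S)
  then have "smooth_fun_on W (\<lambda>y. f y - (\<Sum>a\<in>S. c a * g a y))" "smooth_fun_on W (g a)"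
    by auto
  then have "smooth_fun_on W (\<lambda>y. (f y - (\<Sum>a\<in>S. c a * g a y)) - c a * g a y)"
    using Ck_on_diff_cmult[OF assms(1)] by (auto simp: smooth_fun_on_def)
  then show ?case using insert.hyps by (simp add: algebra_simps)
qed

lemma smooth_fun_on_partial_deriv:
  "smooth_fun_on W f \<Longrightarrow> smooth_fun_on W (partial_deriv i f)"
  unfolding smooth_fun_on_def by (metis Ck_on.simps(2))

lemma smooth_fun_on_continuous: "smooth_fun_on W f \<Longrightarrow> continuous_on W f"
  unfolding smooth_fun_on_def by (metis Ck_on.simps(1))

lemma smooth_fun_on_differentiable:
  assumes "open W" "smooth_fun_on W f" "z \<in> W"
  shows "f differentiable at z"
proof -
  have "Ck_on (Suc 0) W f" using assms(2) unfolding smooth_fun_on_def by blast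
  then show ?thesis
    using assms(1,3) by (simp add: differentiable_on_eq_differentiable_at)
qed

section \<open>Symmetry of second partial derivatives\<close>

lemma partial_deriv_along_axis:
  assumes "f differentiable at (p + s *\<^sub>R axis i 1)"
  shows "((\<lambda>s. f (p + s *\<^sub>R axis i 1)) has_real_derivative partial_deriv i f (p + s *\<^sub>R axis i 1)) (at s)"
proof -
  let ?q = "p + s *\<^sub>R axis i (1::real)"
  let ?D = "frechet_derivative f (at ?q)"
  have D: "(f has_derivative ?D) (at ?q)"
    using assms by (simp add: frechet_derivative_works)
  have "((\<lambda>s. p + s *\<^sub>R axis i (1::real)) has_derivative (\<lambda>h. h *\<^sub>R axis i 1)) (at s)"
    by (auto intro!: derivative_eq_intros)
  from has_derivative_compose[OF this D]
  have "((\<lambda>s. f (p + s *\<^sub>R axis i 1)) has_derivative (\<lambda>h. ?D (h *\<^sub>R axis i 1))) (at s)" .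
  moreover have "?D (h *\<^sub>R axis i 1) = partial_deriv i f ?q * h" for h
    using linear_cmul[OF has_derivative_linear[OF D]] by (simp add: partial_deriv_def)
  ultimately show ?thesis
    by (simp add: has_field_derivative_def)
qed

text \<open>The mean value theorem is applied twice: in direction \<open>i\<close> to the difference
  of two parallel restrictions of \<open>f\<close>, then in direction \<open>j\<close> to
  \<open>partial_deriv i f\<close>. The point of the formula is that its left side is symmetric in
  \<open>i\<close> and \<open>j\<close>. The bound \<open>2 * h < r\<close> keeps the whole
  parallelogram in the ball, as its points are at distance at most \<open>h + h\<close> from
  \<open>z\<close>.\<close>

lemma second_difference_mvt:
  fixes f :: "real ^ 'i::finite \<Rightarrow> real"
  assumes "\<And>y. y \<in> ball z r \<Longrightarrow> f differentiable at y"
    and "\<And>y. y \<in> ball z r \<Longrightarrow> partial_deriv i f differentiable at y"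
    and "0 < h" "2 * h < r"
  shows "\<exists>y \<in> ball z r. f (z + h *\<^sub>R axis i 1 + h *\<^sub>R axis j 1) - f (z + h *\<^sub>R axis i 1)
      - f (z + h *\<^sub>R axis j 1) + f z = h * h * partial_deriv j (partial_deriv i f) y"
proof -
  let ?i = "axis i (1::real) :: real ^ 'i" and ?j = "axis j (1::real) :: real ^ 'i"
  have inball: "z + s *\<^sub>R ?i + t *\<^sub>R ?j \<in> ball z r" if "0 \<le> s" "s \<le> h" "0 \<le> t" "t \<le> h" for s t
  proof -
    have "norm (s *\<^sub>R ?i + t *\<^sub>R ?j) \<le> s + t"
      using that norm_triangle_ineq[of "s *\<^sub>R ?i" "t *\<^sub>R ?j"] by simp
    moreover have "dist z (z + s *\<^sub>R ?i + t *\<^sub>R ?j) = norm (s *\<^sub>R ?i + t *\<^sub>R ?j)"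
      by (metis add.assoc add_diff_cancel_left' dist_commute dist_norm)
    ultimately show ?thesis
      using that assms(4) by simp
  qed
  let ?\<phi> = "\<lambda>s. f ((z + h *\<^sub>R ?j) + s *\<^sub>R ?i) - f (z + s *\<^sub>R ?i)"
  have swap: "z + t *\<^sub>R ?j + s *\<^sub>R ?i = z + s *\<^sub>R ?i + t *\<^sub>R ?j" for s t
    by simp
  have "DERIV ?\<phi> s :> partial_deriv i f ((z + h *\<^sub>R ?j) + s *\<^sub>R ?i) - partial_deriv i f (z + s *\<^sub>R ?i)"
    if "0 \<le> s" "s \<le> h" for s
    using inball[OF that, of h] inball[OF that, of 0] assms(3)
    by (intro DERIV_diff partial_deriv_along_axis assms(1)) (auto simp: swap)
  from MVT2[OF \<open>0 < h\<close> this] obtain s where s: "0 < s" "s < h"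
    "?\<phi> h - ?\<phi> 0 = h * (partial_deriv i f ((z + h *\<^sub>R ?j) + s *\<^sub>R ?i) - partial_deriv i f (z + s *\<^sub>R ?i))"
    by auto
  let ?\<psi> = "\<lambda>t. partial_deriv i f ((z + s *\<^sub>R ?i) + t *\<^sub>R ?j)"
  have "DERIV ?\<psi> t :> partial_deriv j (partial_deriv i f) ((z + s *\<^sub>R ?i) + t *\<^sub>R ?j)"
    if "0 \<le> t" "t \<le> h" for t
    using inball[OF _ _ that, of s] s by (intro partial_deriv_along_axis assms(2)) auto
  from MVT2[OF \<open>0 < h\<close> this] obtain t where t: "0 < t" "t < h"
    "?\<psi> h - ?\<psi> 0 = h * partial_deriv j (partial_deriv i f) ((z + s *\<^sub>R ?i) + t *\<^sub>R ?j)"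
    by auto
  have "?\<phi> h - ?\<phi> 0 = h * h * partial_deriv j (partial_deriv i f) ((z + s *\<^sub>R ?i) + t *\<^sub>R ?j)"
    using s(3) t(3) by (simp add: swap)
  moreover have "z + s *\<^sub>R ?i + t *\<^sub>R ?j \<in> ball z r"
    using s t by (intro inball) auto
  ultimately show ?thesis
    by (intro bexI[of _ "z + s *\<^sub>R ?i + t *\<^sub>R ?j"]) (auto simp: swap)
qed

text \<open>One and the same second difference equals \<open>h * h\<close> times a value of either
  mixed derivative near \<open>z\<close>. So the two derivatives share a value, taken at possibly
  different points of a small ball, and by continuity they cannot differ at
  \<open>z\<close>.\<close>

lemma partial_deriv_commute:
  assumes "open W" "smooth_fun_on W f" "z \<in> W"
  shows "partial_deriv i (partial_deriv j f) z = partial_deriv j (partial_deriv i f) z"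
proof (rule ccontr)
  let ?a = "partial_deriv i (partial_deriv j f)" and ?b = "partial_deriv j (partial_deriv i f)"
  assume ne: "?a z \<noteq> ?b z"
  \<comment> \<open>Half the gap: a common value within \<open>e\<close> of both \<open>?a z\<close>
    and \<open>?b z\<close> would make their distance smaller than \<open>2 * e\<close>, which is
    the distance itself.\<close>
  define e where "e = dist (?a z) (?b z) / 2"
  have "e > 0" using ne by (simp add: e_def)
  have "continuous_on W ?a" "continuous_on W ?b"
    by (intro smooth_fun_on_continuous smooth_fun_on_partial_deriv assms(2))+
  then have "isCont ?a z" "isCont ?b z"
    using assms(1,3) by (auto simp: continuous_on_eq_continuous_at)
  then obtain r1 r2 where r12: "r1 > 0" "\<And>y. dist y z < r1 \<Longrightarrow> dist (?a y) (?a z) < e"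
    "r2 > 0" "\<And>y. dist y z < r2 \<Longrightarrow> dist (?b y) (?b z) < e"
    using \<open>e > 0\<close> by (metis continuous_at_eps_delta dist_commute)
  obtain r3 where r3: "r3 > 0" "ball z r3 \<subseteq> W"
    using assms(1,3) openE by blast
  define r where "r = min r1 (min r2 r3)"
  have r: "r > 0" "\<And>y. y \<in> ball z r \<Longrightarrow> y \<in> W \<and> dist (?a y) (?a z) < e \<and> dist (?b y) (?b z) < e"
    using r12 r3 by (auto simp: r_def dist_commute subset_iff)
  define h where "h = r / 3"
  have h: "0 < h" "2 * h < r" using r(1) by (auto simp: h_def)
  have diff: "f differentiable at y" "partial_deriv k f differentiable at y" if "y \<in> ball z r" for y k
    using r(2)[OF that] assms by (auto intro: smooth_fun_on_differentiable smooth_fun_on_partial_deriv)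
  obtain y1 where y1: "y1 \<in> ball z r" "f (z + h *\<^sub>R axis j 1 + h *\<^sub>R axis i 1) - f (z + h *\<^sub>R axis j 1)
      - f (z + h *\<^sub>R axis i 1) + f z = h * h * ?a y1"
    using second_difference_mvt[OF diff h] by blast
  obtain y2 where y2: "y2 \<in> ball z r" "f (z + h *\<^sub>R axis i 1 + h *\<^sub>R axis j 1) - f (z + h *\<^sub>R axis i 1)
      - f (z + h *\<^sub>R axis j 1) + f z = h * h * ?b y2"
    using second_difference_mvt[OF diff h] by blast
  have "z + h *\<^sub>R axis j 1 + h *\<^sub>R axis i 1 = z + h *\<^sub>R axis i 1 + h *\<^sub>R axis j (1::real)"
    by simp
  from y1(2)[unfolded this] y2(2) have "h * h * ?a y1 = h * h * ?b y2" by linarith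
  then have "?a y1 = ?b y2" using h by simp
  moreover have "dist (?a y1) (?a z) < e" "dist (?b y2) (?b z) < e" using r(2) y1(1) y2(1) by auto
  ultimately have "dist (?a z) (?b z) < 2 * e"
    by (smt (verit) dist_commute dist_triangle)
  then show False by (simp add: e_def)
qed

section \<open>Differentiability of the inverse matrix\<close>

lemma matrix_inv_mult:
  fixes A :: "real ^ 'n ^ 'n"
  assumes "det A \<noteq> 0"
  shows "A ** matrix_inv A = mat 1" "matrix_inv A ** A = mat 1"
proof -
  have "invertible A" using assms by (simp add: invertible_det_nz)
  then have "A ** matrix_inv A = mat 1 \<and> matrix_inv A ** A = mat 1"
    unfolding invertible_def matrix_inv_def by (rule someI_ex)
  then show "A ** matrix_inv A = mat 1" "matrix_inv A ** A = mat 1" by auto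
qed

text \<open>Column \<open>b\<close> of the inverse solves the linear system with right side
  \<open>axis b 1\<close>, so Cramer's rule applies. This exhibits each entry as a quotient of
  determinants, that is, of polynomials in the entries of \<open>A\<close>.\<close>

lemma matrix_inv_nth_cramer:
  fixes A :: "real ^ 'n ^ 'n"
  assumes "det A \<noteq> 0"
  shows "matrix_inv A $ a $ b =
    det (\<chi> i j. if j = a then (if i = b then 1 else 0) else A $ i $ j) / det A"
proof -
  have "A *v (matrix_inv A *v axis b 1) = axis b 1"
    using matrix_inv_mult[OF assms] by (simp add: matrix_vector_mul_assoc)
  then have "matrix_inv A *v axis b 1 =
      (\<chi> k. det (\<chi> i j. if j = k then axis b 1 $ i else A $ i $ j) / det A)"
    using cramer[OF assms] by blast
  then have "(matrix_inv A *v axis b 1) $ a =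
      det (\<chi> i j. if j = a then axis b 1 $ i else A $ i $ j) / det A" by simp
  moreover have "(matrix_inv A *v axis b 1) $ a = matrix_inv A $ a $ b"
    by (simp add: matrix_vector_mult_basis column_def)
  moreover have "axis b (1::real) $ i = (if i = b then 1 else 0)" for i
    by (simp add: axis_def)
  ultimately show ?thesis by (simp only:)
qed

lemma differentiable_prod:
  fixes f :: "'b \<Rightarrow> 'a::real_normed_vector \<Rightarrow> real"
  assumes "\<And>i. i \<in> I \<Longrightarrow> f i differentiable at z"
  shows "(\<lambda>y. \<Prod>i\<in>I. f i y) differentiable at z"
proof -
  have "\<And>i. i \<in> I \<Longrightarrow> (f i has_derivative frechet_derivative (f i) (at z)) (at z)"
    using assms by (simp add: frechet_derivative_works)
  then have "((\<lambda>y. \<Prod>i\<in>I. f i y) has_derivative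
      (\<lambda>h. \<Sum>i\<in>I. frechet_derivative (f i) (at z) h * (\<Prod>j\<in>I - {i}. f j z))) (at z)"
    by (rule has_derivative_prod)
  then show ?thesis by (rule differentiableI)
qed

lemma differentiable_det:
  fixes M :: "'a::real_normed_vector \<Rightarrow> real ^ 'n ^ 'n"
  assumes "\<And>i j. (\<lambda>y. M y $ i $ j) differentiable at z"
  shows "(\<lambda>y. det (M y)) differentiable at z"
proof -
  have "(\<lambda>y. of_int (sign p) * (\<Prod>i\<in>UNIV. M y $ i $ p i)) differentiable at z" for p
    using differentiable_prod[of UNIV "\<lambda>i y. M y $ i $ p i", OF assms]
    by (simp add: differentiable_mult)
  then show ?thesis
    unfolding det_def
    using differentiable_sum[of "{p. p permutes (UNIV :: 'n set)}"
        "\<lambda>p y. of_int (sign p) * (\<Prod>i\<in>UNIV. M y $ i $ p i)" "at z"]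
    by (simp add: finite_permutations)
qed

lemma differentiable_matrix_inv_nth:
  fixes M :: "'a::real_normed_vector \<Rightarrow> real ^ 'n ^ 'n"
  assumes "open W" "z \<in> W" "\<And>y. y \<in> W \<Longrightarrow> det (M y) \<noteq> 0"
    and M: "\<And>i j. (\<lambda>y. M y $ i $ j) differentiable at z"
  shows "(\<lambda>y. matrix_inv (M y) $ a $ b) differentiable at z"
proof -
  let ?N = "\<lambda>y. (\<chi> i j. if j = a then (if i = b then 1 else 0) else M y $ i $ j) :: real ^ 'n ^ 'n"
  have "(\<lambda>y. ?N y $ i $ j) differentiable at z" for i j
    using M by (cases "j = a"; simp)
  then have "(\<lambda>y. det (?N y) / det (M y)) differentiable at z"
    using assms by (intro differentiable_divide differentiable_det) auto
  then obtain D where "((\<lambda>y. det (?N y) / det (M y)) has_derivative D) (at z)"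
    unfolding differentiable_def by blast
  \<comment> \<open>Cramer's quotient agrees with \<open>matrix_inv\<close> only where the
    determinant is nonzero; this holds throughout the open set \<open>W\<close>, so the derivative
    carries over.\<close>
  from has_derivative_transform_within_open[OF this assms(1,2)]
  have "((\<lambda>y. matrix_inv (M y) $ a $ b) has_derivative D) (at z)"
    using assms(3) by (simp add: matrix_inv_nth_cramer)
  then show ?thesis unfolding differentiable_def by blast
qed

section \<open>The Jacobi identity of the Poisson bracket\<close>

text \<open>Moves the innermost summation index to the outside. It aligns the cyclic permutations in
  the Jacobi identity, and later pulls out the sum over the coefficients of a shift.\<close>

lemma sum_rotate3:
  fixes f :: "'i::finite \<Rightarrow> 'i \<Rightarrow> 'i \<Rightarrow> real"
  shows "(\<Sum>i\<in>UNIV. \<Sum>j\<in>UNIV. \<Sum>k\<in>UNIV. f i j k) = (\<Sum>i\<in>UNIV. \<Sum>j\<in>UNIV. \<Sum>k\<in>UNIV. f j k i)"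
proof -
  have "(\<Sum>i\<in>UNIV. \<Sum>j\<in>UNIV. \<Sum>k\<in>UNIV. f j k i) = (\<Sum>j\<in>UNIV. \<Sum>i\<in>UNIV. \<Sum>k\<in>UNIV. f j k i)"
    by (rule sum.swap)
  also have "\<dots> = (\<Sum>j\<in>UNIV. \<Sum>k\<in>UNIV. \<Sum>i\<in>UNIV. f j k i)"
    by (intro sum.cong refl sum.swap)
  finally show ?thesis by simp
qed

text \<open>At a fixed point the Jacobi identity becomes a statement about numbers:
  \<open>a\<close>, \<open>b\<close>, \<open>c\<close> are the gradients, \<open>Ha\<close>,
  \<open>Hb\<close>, \<open>Hc\<close> the Hessians, and \<open>dw p j k\<close> is the derivative
  of the tensor in direction \<open>p\<close>. Each \<open>T\<close> is a nested bracket after the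
  product rule. Once the Hessians have cancelled, what is left is \<open>jac\<close> contracted with
  the three gradients.\<close>

lemma jacobi_sum_algebra:
  fixes a b c :: "'i::finite \<Rightarrow> real" and w Ha Hb Hc :: "'i \<Rightarrow> 'i \<Rightarrow> real"
    and dw :: "'i \<Rightarrow> 'i \<Rightarrow> 'i \<Rightarrow> real"
  assumes skew: "\<And>i j. w i j = - w j i"
    and sym: "\<And>p k. Ha p k = Ha k p" "\<And>p k. Hb p k = Hb k p" "\<And>p k. Hc p k = Hc k p"
    and jac: "\<And>i j k. (\<Sum>p\<in>UNIV. w i p * dw p j k) + (\<Sum>p\<in>UNIV. w j p * dw p k i)
      + (\<Sum>p\<in>UNIV. w k p * dw p i j) = 0"
  defines "T \<equiv> \<lambda>u v x Hv Hx. \<Sum>i\<in>UNIV. \<Sum>p\<in>UNIV. u i * w i p *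
      (\<Sum>j\<in>UNIV. \<Sum>k\<in>UNIV. Hv p j * w j k * x k + v j * dw p j k * x k + v j * w j k * Hx p k)"
  shows "T a b c Hb Hc + T b c a Hc Ha + T c a b Ha Hb = 0"
proof -
  \<comment> \<open>\<open>Q\<close> collects the terms with second derivatives: by \<open>skew\<close> each Hessian is contracted with the
    Hamiltonian vector fields \<open>X\<close> of the other two functions, once with each sign.\<close>
  define X where "X u p = (\<Sum>i\<in>UNIV. u i * w i p)" for u p
  define Q where "Q u v H = (\<Sum>p\<in>UNIV. \<Sum>k\<in>UNIV. X u p * X v k * H p k)" for u v and H :: "'i \<Rightarrow> 'i \<Rightarrow> real"
  define S where "S i j k = (\<Sum>p\<in>UNIV. w i p * dw p j k)" for i j k
  define R where "R u v x = (\<Sum>i\<in>UNIV. \<Sum>j\<in>UNIV. \<Sum>k\<in>UNIV. u i * v j * x k * S i j k)" for u v x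
  have wX: "(\<Sum>k\<in>UNIV. w j k * x k) = - X x j" for x j
    unfolding X_def sum_negf[symmetric] by (intro sum.cong refl) (simp add: skew[of j])
  have "T u v x Hv Hx = R u v x + Q u v Hx - Q u x Hv" for u v x Hv Hx
  proof -
    have inner: "(\<Sum>j\<in>UNIV. \<Sum>k\<in>UNIV. Hv p j * w j k * x k + v j * dw p j k * x k + v j * w j k * Hx p k)
      = (\<Sum>j\<in>UNIV. \<Sum>k\<in>UNIV. v j * dw p j k * x k) + (\<Sum>k\<in>UNIV. X v k * Hx p k) - (\<Sum>k\<in>UNIV. X x k * Hv p k)"
      for p
    proof -
      have "(\<Sum>j\<in>UNIV. \<Sum>k\<in>UNIV. Hv p j * w j k * x k) = - (\<Sum>k\<in>UNIV. X x k * Hv p k)"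
      proof -
        have "(\<Sum>k\<in>UNIV. Hv p j * w j k * x k) = - (X x j * Hv p j)" for j
          by (simp only: mult.assoc sum_distrib_left[symmetric] wX) simp
        then show ?thesis by (simp add: sum_negf)
      qed
      moreover have "(\<Sum>j\<in>UNIV. \<Sum>k\<in>UNIV. v j * w j k * Hx p k) = (\<Sum>k\<in>UNIV. X v k * Hx p k)"
        by (subst sum.swap) (simp add: X_def sum_distrib_right)
      ultimately show ?thesis by (simp add: sum.distrib)
    qed
    have "T u v x Hv Hx = (\<Sum>p\<in>UNIV. X u p * ((\<Sum>j\<in>UNIV. \<Sum>k\<in>UNIV. v j * dw p j k * x k)
        + (\<Sum>k\<in>UNIV. X v k * Hx p k) - (\<Sum>k\<in>UNIV. X x k * Hv p k)))"
      unfolding T_def inner by (subst sum.swap) (simp add: X_def sum_distrib_right)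
    also have "\<dots> = (\<Sum>p\<in>UNIV. X u p * (\<Sum>j\<in>UNIV. \<Sum>k\<in>UNIV. v j * dw p j k * x k)) + Q u v Hx - Q u x Hv"
      by (simp add: Q_def algebra_simps sum.distrib sum_subtractf sum_distrib_left)
    also have "(\<Sum>p\<in>UNIV. X u p * (\<Sum>j\<in>UNIV. \<Sum>k\<in>UNIV. v j * dw p j k * x k)) = R u v x"
    proof -
      have "(\<Sum>p\<in>UNIV. X u p * (\<Sum>j\<in>UNIV. \<Sum>k\<in>UNIV. v j * dw p j k * x k)) =
          (\<Sum>p\<in>UNIV. \<Sum>i\<in>UNIV. u i * w i p * (\<Sum>j\<in>UNIV. \<Sum>k\<in>UNIV. v j * dw p j k * x k))"
        by (simp add: X_def sum_distrib_right)
      also have "\<dots> = (\<Sum>i\<in>UNIV. \<Sum>p\<in>UNIV. u i * w i p * (\<Sum>j\<in>UNIV. \<Sum>k\<in>UNIV. v j * dw p j k * x k))"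
        by (rule sum.swap)
      also have "\<dots> = (\<Sum>i\<in>UNIV. \<Sum>p\<in>UNIV. \<Sum>j\<in>UNIV. \<Sum>k\<in>UNIV. u i * v j * x k * (w i p * dw p j k))"
        by (simp add: sum_distrib_left mult.assoc mult.left_commute mult.commute)
      also have "\<dots> = (\<Sum>i\<in>UNIV. \<Sum>j\<in>UNIV. \<Sum>p\<in>UNIV. \<Sum>k\<in>UNIV. u i * v j * x k * (w i p * dw p j k))"
        by (intro sum.cong refl sum.swap)
      also have "\<dots> = (\<Sum>i\<in>UNIV. \<Sum>j\<in>UNIV. \<Sum>k\<in>UNIV. \<Sum>p\<in>UNIV. u i * v j * x k * (w i p * dw p j k))"
        by (intro sum.cong refl sum.swap)
      finally show ?thesis by (simp add: R_def S_def sum_distrib_left)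
    qed
    finally show ?thesis .
  qed
  moreover have Qsym: "Q u v H = Q v u H" if "\<And>p k. H p k = H k p" for u v H
    unfolding Q_def by (subst sum.swap) (intro sum.cong refl, simp add: that[of _ _] mult.commute mult.left_commute)
  moreover have "R a b c + R b c a + R c a b = 0"
  proof -
    \<comment> \<open>The indices are renamed so that all three sums carry the coefficient
      \<open>a i * b j * c k\<close>; the permutation then sits on \<open>S\<close> alone, in the
      form of \<open>jac\<close>.\<close>
    have "R b c a = (\<Sum>i\<in>UNIV. \<Sum>j\<in>UNIV. \<Sum>k\<in>UNIV. b j * c k * a i * S j k i)"
      unfolding R_def by (rule sum_rotate3)
    moreover have "R c a b = (\<Sum>i\<in>UNIV. \<Sum>j\<in>UNIV. \<Sum>k\<in>UNIV. c k * a i * b j * S k i j)"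
      unfolding R_def by (rule sum_rotate3[symmetric])
    ultimately have "R a b c + R b c a + R c a b =
        (\<Sum>i\<in>UNIV. \<Sum>j\<in>UNIV. \<Sum>k\<in>UNIV. a i * b j * c k * (S i j k + S j k i + S k i j))"
      unfolding R_def by (simp add: sum.distrib[symmetric] algebra_simps)
    then show ?thesis using jac by (simp add: S_def)
  qed
  ultimately show ?thesis
    using Qsym[OF sym(1), of b c] Qsym[OF sym(2), of c a] Qsym[OF sym(3), of a b] by simp
qed

lemma partial_deriv_mult3:
  assumes "f differentiable at z" "g differentiable at z" "h differentiable at z"
  shows "partial_deriv p (\<lambda>y. f y * g y * h y) z =
    partial_deriv p f z * g z * h z + f z * partial_deriv p g z * h z + f z * g z * partial_deriv p h z"
  using assms by (simp add: partial_deriv_mult differentiable_mult algebra_simps)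

lemma differentiable_poisson_bracket:
  assumes "\<And>i j. (\<lambda>y. \<omega> y $ i $ j) differentiable at z"
    and "\<And>i. partial_deriv i A differentiable at z" "\<And>i. partial_deriv i B differentiable at z"
  shows "poisson_bracket \<omega> A B differentiable at z"
  unfolding poisson_bracket_def[abs_def]
  using assms by (simp add: differentiable_mult)

lemma partial_deriv_poisson_bracket:
  assumes "\<And>i j. (\<lambda>y. \<omega> y $ i $ j) differentiable at z"
    and "\<And>i. partial_deriv i A differentiable at z" "\<And>i. partial_deriv i B differentiable at z"
  shows "partial_deriv p (poisson_bracket \<omega> A B) z = (\<Sum>j\<in>UNIV. \<Sum>k\<in>UNIV.
    partial_deriv p (partial_deriv j A) z * \<omega> z $ j $ k * partial_deriv k B z +
    partial_deriv j A z * partial_deriv p (\<lambda>y. \<omega> y $ j $ k) z * partial_deriv k B z +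
    partial_deriv j A z * \<omega> z $ j $ k * partial_deriv p (partial_deriv k B) z)"
  unfolding poisson_bracket_def[abs_def]
  using assms by (simp add: partial_deriv_sum partial_deriv_mult3 differentiable_mult)

lemma poisson_tensor_on_skew:
  assumes "poisson_tensor_on U \<omega>" "z \<in> U"
  shows "\<omega> z $ i $ j = - \<omega> z $ j $ i"
  using assms unfolding poisson_tensor_on_def by blast

lemma poisson_tensor_on_differentiable:
  assumes "poisson_tensor_on U \<omega>" "open U" "z \<in> U"
  shows "(\<lambda>y. \<omega> y $ i $ j) differentiable at z"
  using assms smooth_fun_on_differentiable unfolding poisson_tensor_on_def by blast

lemma poisson_bracket_skew:
  assumes "poisson_tensor_on U \<omega>" "z \<in> U"
  shows "poisson_bracket \<omega> A B z = - poisson_bracket \<omega> B A z"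
proof -
  have "poisson_bracket \<omega> A B z = (\<Sum>i\<in>UNIV. \<Sum>j\<in>UNIV. partial_deriv j A z * \<omega> z $ j $ i * partial_deriv i B z)"
    unfolding poisson_bracket_def by (rule sum.swap)
  also have "\<dots> = (\<Sum>i\<in>UNIV. \<Sum>j\<in>UNIV. - (partial_deriv i B z * \<omega> z $ i $ j * partial_deriv j A z))"
  proof (intro sum.cong refl)
    fix i j
    have "\<omega> z $ j $ i = - (\<omega> z $ i $ j)"
      by (rule poisson_tensor_on_skew[OF assms])
    then show "partial_deriv j A z * \<omega> z $ j $ i * partial_deriv i B z =
        - (partial_deriv i B z * \<omega> z $ i $ j * partial_deriv j A z)" by simp
  qed
  finally show ?thesis by (simp add: poisson_bracket_def sum_negf)
qed

lemma poisson_bracket_jacobi: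
  assumes \<omega>: "poisson_tensor_on U \<omega>" and "open U" "open W" "W \<subseteq> U" "z \<in> W"
    and A: "smooth_fun_on W A" and B: "smooth_fun_on W B" and C: "smooth_fun_on W C"
  shows "poisson_bracket \<omega> A (poisson_bracket \<omega> B C) z +
    poisson_bracket \<omega> B (poisson_bracket \<omega> C A) z +
    poisson_bracket \<omega> C (poisson_bracket \<omega> A B) z = 0"
proof -
  have "z \<in> U" using assms by auto
  have w: "(\<lambda>y. \<omega> y $ i $ j) differentiable at z" for i j
    by (rule poisson_tensor_on_differentiable[OF \<omega> \<open>open U\<close> \<open>z \<in> U\<close>])
  have d: "partial_deriv i f differentiable at z" if "smooth_fun_on W f" for i f
    using that assms by (blast intro: smooth_fun_on_differentiable smooth_fun_on_partial_deriv)
  note expand = partial_deriv_poisson_bracket[OF w d d]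
  \<comment> \<open>Only the outer brackets are unfolded. The inner ones enter through their partial
    derivatives, which gives exactly the shape of \<open>T\<close>.\<close>
  show ?thesis
    unfolding poisson_bracket_def[of \<omega> _ "poisson_bracket _ _ _"] expand[OF A B] expand[OF B C] expand[OF C A]
  proof (rule jacobi_sum_algebra)
    show "\<omega> z $ i $ j = - \<omega> z $ j $ i" for i j
      by (rule poisson_tensor_on_skew[OF \<omega> \<open>z \<in> U\<close>])
    show "(\<Sum>p\<in>UNIV. \<omega> z $ i $ p * partial_deriv p (\<lambda>y. \<omega> y $ j $ k) z) +
        (\<Sum>p\<in>UNIV. \<omega> z $ j $ p * partial_deriv p (\<lambda>y. \<omega> y $ k $ i) z) +
        (\<Sum>p\<in>UNIV. \<omega> z $ k $ p * partial_deriv p (\<lambda>y. \<omega> y $ i $ j) z) = 0" for i j k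
      using \<omega> \<open>z \<in> U\<close> unfolding poisson_tensor_on_def by blast
  qed (use assms in \<open>auto intro: partial_deriv_commute\<close>)
qed

section \<open>Constraints as Casimir functions, and invariance under shifts\<close>

lemma poisson_bracket_diff_sum_left:
  fixes \<Phi> :: "'a::finite \<Rightarrow> real ^ 'i::finite \<Rightarrow> real"
  assumes "A differentiable at z" "\<And>a. \<Phi> a differentiable at z"
  shows "poisson_bracket \<omega> (\<lambda>y. A y - (\<Sum>a\<in>UNIV. c a * \<Phi> a y)) B z =
    poisson_bracket \<omega> A B z - (\<Sum>a\<in>UNIV. c a * poisson_bracket \<omega> (\<Phi> a) B z)"
    (is "poisson_bracket _ ?A' _ _ = _")
proof -
  have "partial_deriv i ?A' z = partial_deriv i A z - (\<Sum>a\<in>UNIV. c a * partial_deriv i (\<Phi> a) z)" for i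
  proof -
    have c\<Phi>: "(\<lambda>y. c a * \<Phi> a y) differentiable at z" for a
      using assms(2) by simp
    have "(\<lambda>y. \<Sum>a\<in>UNIV. c a * \<Phi> a y) differentiable at z"
      using assms(2) by simp
    from partial_deriv_diff[OF assms(1) this] show ?thesis
      using partial_deriv_sum[of UNIV "\<lambda>a y. c a * \<Phi> a y" z i] c\<Phi>
      by (simp add: partial_deriv_cmult[OF assms(2)])
  qed
  then have "poisson_bracket \<omega> ?A' B z = poisson_bracket \<omega> A B z - (\<Sum>i\<in>UNIV. \<Sum>j\<in>UNIV. \<Sum>a\<in>UNIV.
      c a * (partial_deriv i (\<Phi> a) z * \<omega> z $ i $ j * partial_deriv j B z))"
    by (simp add: poisson_bracket_def left_diff_distrib sum_subtractf sum_distrib_right mult.assoc)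
  also have "(\<Sum>i\<in>UNIV. \<Sum>j\<in>UNIV. \<Sum>a\<in>UNIV. c a * (partial_deriv i (\<Phi> a) z * \<omega> z $ i $ j * partial_deriv j B z)) =
      (\<Sum>i\<in>UNIV. \<Sum>a\<in>UNIV. \<Sum>j\<in>UNIV. c a * (partial_deriv i (\<Phi> a) z * \<omega> z $ i $ j * partial_deriv j B z))"
    by (intro sum.cong refl sum.swap)
  also have "\<dots> = (\<Sum>a\<in>UNIV. \<Sum>i\<in>UNIV. \<Sum>j\<in>UNIV. c a * (partial_deriv i (\<Phi> a) z * \<omega> z $ i $ j * partial_deriv j B z))"
    by (rule sum.swap)
  finally show ?thesis by (simp add: poisson_bracket_def sum_distrib_left)
qed

lemma poisson_bracket_diff_sum_right:
  fixes \<Phi> :: "'a::finite \<Rightarrow> real ^ 'i::finite \<Rightarrow> real"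
  assumes "poisson_tensor_on U \<omega>" "z \<in> U" "A differentiable at z" "\<And>a. \<Phi> a differentiable at z"
  shows "poisson_bracket \<omega> B (\<lambda>y. A y - (\<Sum>a\<in>UNIV. c a * \<Phi> a y)) z =
    poisson_bracket \<omega> B A z - (\<Sum>a\<in>UNIV. c a * poisson_bracket \<omega> B (\<Phi> a) z)"
  unfolding poisson_bracket_skew[OF assms(1,2), of B]
  using poisson_bracket_diff_sum_left[of A z \<Phi> \<omega> c B] assms(3,4) by (simp add: sum_negf)

text \<open>In the correction term the constraint matrix meets its inverse; the product is the
  identity matrix, so the correction reproduces the Poisson bracket of \<open>\<Phi> a\<close> with
  \<open>B\<close> and cancels it.\<close>

lemma dirac_bracket_constraint_left:
  assumes "det (constraint_matrix \<omega> \<Phi> z) \<noteq> 0"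
  shows "dirac_bracket \<omega> \<Phi> (\<Phi> a) B z = 0"
proof -
  let ?M = "constraint_matrix \<omega> \<Phi> z"
  have M: "poisson_bracket \<omega> (\<Phi> \<alpha>) (\<Phi> \<beta>) z = ?M $ \<alpha> $ \<beta>" for \<alpha> \<beta>
    by (simp add: constraint_matrix_def)
  have "(\<Sum>\<alpha>\<in>UNIV. \<Sum>\<beta>\<in>UNIV. ?M $ a $ \<alpha> * matrix_inv ?M $ \<alpha> $ \<beta> * poisson_bracket \<omega> (\<Phi> \<beta>) B z)
      = (\<Sum>\<beta>\<in>UNIV. (?M ** matrix_inv ?M) $ a $ \<beta> * poisson_bracket \<omega> (\<Phi> \<beta>) B z)"
    by (subst sum.swap) (simp add: matrix_matrix_mult_def sum_distrib_right)
  also have "\<dots> = poisson_bracket \<omega> (\<Phi> a) B z"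
    by (simp add: matrix_inv_mult[OF assms] mat_def if_distrib[of "\<lambda>x. x * _"] cong: if_cong)
  finally show ?thesis by (simp add: dirac_bracket_def M)
qed

lemma dirac_bracket_constraint_right:
  assumes "det (constraint_matrix \<omega> \<Phi> z) \<noteq> 0"
  shows "dirac_bracket \<omega> \<Phi> B (\<Phi> a) z = 0"
proof -
  let ?M = "constraint_matrix \<omega> \<Phi> z"
  have M: "poisson_bracket \<omega> (\<Phi> \<alpha>) (\<Phi> \<beta>) z = ?M $ \<alpha> $ \<beta>" for \<alpha> \<beta>
    by (simp add: constraint_matrix_def)
  have "(\<Sum>\<alpha>\<in>UNIV. \<Sum>\<beta>\<in>UNIV. poisson_bracket \<omega> B (\<Phi> \<alpha>) z * matrix_inv ?M $ \<alpha> $ \<beta> * ?M $ \<beta> $ a)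
      = (\<Sum>\<alpha>\<in>UNIV. poisson_bracket \<omega> B (\<Phi> \<alpha>) z * (matrix_inv ?M ** ?M) $ \<alpha> $ a)"
    by (simp add: matrix_matrix_mult_def sum_distrib_left mult.assoc)
  also have "\<dots> = poisson_bracket \<omega> B (\<Phi> a) z"
    by (simp add: matrix_inv_mult[OF assms] mat_def if_distrib[of "\<lambda>x. _ * x"] cong: if_cong)
  finally show ?thesis by (simp add: dirac_bracket_def M)
qed

text \<open>By linearity the shift changes the value by a combination of the Dirac brackets of
  \<open>\<Phi> a\<close> with \<open>B\<close>, which vanish. \<open>B\<close> is an arbitrary
  function, so it may itself be a Dirac bracket.\<close>

lemma dirac_bracket_shift_left:
  assumes "det (constraint_matrix \<omega> \<Phi> z) \<noteq> 0"
    and "A differentiable at z" "\<And>a. \<Phi> a differentiable at z"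
  shows "dirac_bracket \<omega> \<Phi> (\<lambda>y. A y - (\<Sum>a\<in>UNIV. c a * \<Phi> a y)) B z = dirac_bracket \<omega> \<Phi> A B z"
proof -
  let ?D = "matrix_inv (constraint_matrix \<omega> \<Phi> z)"
  let ?P = "\<lambda>A B. poisson_bracket \<omega> A B z"
  have "dirac_bracket \<omega> \<Phi> (\<lambda>y. A y - (\<Sum>a\<in>UNIV. c a * \<Phi> a y)) B z =
      dirac_bracket \<omega> \<Phi> A B z - ((\<Sum>a\<in>UNIV. c a * ?P (\<Phi> a) B) -
        (\<Sum>\<alpha>\<in>UNIV. \<Sum>\<beta>\<in>UNIV. \<Sum>a\<in>UNIV. c a * (?P (\<Phi> a) (\<Phi> \<alpha>) * ?D $ \<alpha> $ \<beta> * ?P (\<Phi> \<beta>) B)))"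
    unfolding dirac_bracket_def poisson_bracket_diff_sum_left[OF assms(2,3)]
    by (simp add: left_diff_distrib sum_subtractf sum_distrib_right mult.assoc)
  also have "(\<Sum>\<alpha>\<in>UNIV. \<Sum>\<beta>\<in>UNIV. \<Sum>a\<in>UNIV. c a * (?P (\<Phi> a) (\<Phi> \<alpha>) * ?D $ \<alpha> $ \<beta> * ?P (\<Phi> \<beta>) B)) =
      (\<Sum>a\<in>UNIV. \<Sum>\<alpha>\<in>UNIV. \<Sum>\<beta>\<in>UNIV. c a * (?P (\<Phi> a) (\<Phi> \<alpha>) * ?D $ \<alpha> $ \<beta> * ?P (\<Phi> \<beta>) B))"
    by (rule sum_rotate3)
  also have "(\<Sum>a\<in>UNIV. c a * ?P (\<Phi> a) B) - \<dots> = (\<Sum>a\<in>UNIV. c a * dirac_bracket \<omega> \<Phi> (\<Phi> a) B z)"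
    by (simp add: dirac_bracket_def right_diff_distrib sum_subtractf sum_distrib_left)
  finally show ?thesis by (simp add: dirac_bracket_constraint_left[OF assms(1)])
qed

lemma dirac_bracket_shift_right:
  assumes "poisson_tensor_on U \<omega>" "z \<in> U" "det (constraint_matrix \<omega> \<Phi> z) \<noteq> 0"
    and "A differentiable at z" "\<And>a. \<Phi> a differentiable at z"
  shows "dirac_bracket \<omega> \<Phi> B (\<lambda>y. A y - (\<Sum>a\<in>UNIV. c a * \<Phi> a y)) z = dirac_bracket \<omega> \<Phi> B A z"
proof -
  let ?D = "matrix_inv (constraint_matrix \<omega> \<Phi> z)"
  let ?P = "\<lambda>A B. poisson_bracket \<omega> A B z"
  have "dirac_bracket \<omega> \<Phi> B (\<lambda>y. A y - (\<Sum>a\<in>UNIV. c a * \<Phi> a y)) z =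
      dirac_bracket \<omega> \<Phi> B A z - ((\<Sum>a\<in>UNIV. c a * ?P B (\<Phi> a)) -
        (\<Sum>\<alpha>\<in>UNIV. \<Sum>\<beta>\<in>UNIV. \<Sum>a\<in>UNIV. c a * (?P B (\<Phi> \<alpha>) * ?D $ \<alpha> $ \<beta> * ?P (\<Phi> \<beta>) (\<Phi> a))))"
    unfolding dirac_bracket_def poisson_bracket_diff_sum_right[OF assms(1,2,4,5)]
    by (simp add: right_diff_distrib sum_subtractf sum_distrib_left mult.left_commute)
  also have "(\<Sum>\<alpha>\<in>UNIV. \<Sum>\<beta>\<in>UNIV. \<Sum>a\<in>UNIV. c a * (?P B (\<Phi> \<alpha>) * ?D $ \<alpha> $ \<beta> * ?P (\<Phi> \<beta>) (\<Phi> a))) =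
      (\<Sum>a\<in>UNIV. \<Sum>\<alpha>\<in>UNIV. \<Sum>\<beta>\<in>UNIV. c a * (?P B (\<Phi> \<alpha>) * ?D $ \<alpha> $ \<beta> * ?P (\<Phi> \<beta>) (\<Phi> a)))"
    by (rule sum_rotate3)
  also have "(\<Sum>a\<in>UNIV. c a * ?P B (\<Phi> a)) - \<dots> = (\<Sum>a\<in>UNIV. c a * dirac_bracket \<omega> \<Phi> B (\<Phi> a) z)"
    by (simp add: dirac_bracket_def right_diff_distrib sum_subtractf sum_distrib_left)
  finally show ?thesis by (simp add: dirac_bracket_constraint_right[OF assms(3)])
qed

lemma poisson_bracket_cong_right:
  assumes "\<And>i. partial_deriv i B z = partial_deriv i B' z"
  shows "poisson_bracket \<omega> A B z = poisson_bracket \<omega> A B' z"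
  using assms by (simp add: poisson_bracket_def)

lemma dirac_bracket_cong_right:
  assumes "\<And>i. partial_deriv i B z = partial_deriv i B' z"
  shows "dirac_bracket \<omega> \<Phi> A B z = dirac_bracket \<omega> \<Phi> A B' z"
  using poisson_bracket_cong_right[OF assms] by (simp add: dirac_bracket_def)

lemma exists_shift_commuting_with_constraints:
  assumes "det (constraint_matrix \<omega> \<Phi> z) \<noteq> 0"
    and "A differentiable at z" "\<And>a. \<Phi> a differentiable at z"
  shows "\<exists>c. \<forall>b. poisson_bracket \<omega> (\<lambda>y. A y - (\<Sum>a\<in>UNIV. c a * \<Phi> a y)) (\<Phi> b) z = 0"
proof -
  let ?D = "matrix_inv (constraint_matrix \<omega> \<Phi> z)"
  \<comment> \<open>The row vector of the brackets of \<open>A\<close> with the constraints,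
    multiplied by the inverse constraint matrix: the solution of the linear system for the
    coefficients.\<close>
  define c where "c a = (\<Sum>g\<in>UNIV. poisson_bracket \<omega> A (\<Phi> g) z * ?D $ g $ a)" for a
  have "(\<Sum>a\<in>UNIV. c a * poisson_bracket \<omega> (\<Phi> a) (\<Phi> b) z) = poisson_bracket \<omega> A (\<Phi> b) z" for b
  proof -
    \<comment> \<open>The Casimir property, with the correction term moved to the other side, says
      precisely that \<open>c\<close> solves the system.\<close>
    have "dirac_bracket \<omega> \<Phi> A (\<Phi> b) z = 0"
      by (rule dirac_bracket_constraint_right[OF assms(1)])
    then have "poisson_bracket \<omega> A (\<Phi> b) z = (\<Sum>\<alpha>\<in>UNIV. \<Sum>\<beta>\<in>UNIV.
        poisson_bracket \<omega> A (\<Phi> \<alpha>) z * ?D $ \<alpha> $ \<beta> * poisson_bracket \<omega> (\<Phi> \<beta>) (\<Phi> b) z)"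
      by (simp add: dirac_bracket_def)
    also have "\<dots> = (\<Sum>a\<in>UNIV. c a * poisson_bracket \<omega> (\<Phi> a) (\<Phi> b) z)"
      by (subst sum.swap) (simp add: c_def sum_distrib_right)
    finally show ?thesis by simp
  qed
  then show ?thesis
    by (intro exI[of _ c]) (simp add: poisson_bracket_diff_sum_left[OF assms(2,3)])
qed


section \<open>The Jacobi identity of the Dirac bracket\<close>

lemma constraint_matrix_differentiable:
  assumes "poisson_tensor_on U \<omega>" "open U" "z \<in> U" "\<And>a. smooth_fun_on U (\<Phi> a)"
  shows "(\<lambda>y. constraint_matrix \<omega> \<Phi> y $ a $ b) differentiable at z"
proof -
  have "partial_deriv i (\<Phi> a) differentiable at z" for i a
    using assms by (blast intro: smooth_fun_on_differentiable smooth_fun_on_partial_deriv)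
  from differentiable_poisson_bracket[OF poisson_tensor_on_differentiable[OF assms(1-3)] this this]
  show ?thesis by (simp add: constraint_matrix_def)
qed

lemma open_dirac_domain:
  assumes "poisson_tensor_on U \<omega>" "open U" "\<And>a. smooth_fun_on U (\<Phi> a)"
  shows "open (dirac_domain U \<omega> \<Phi>)"
proof -
  have "(\<lambda>y. det (constraint_matrix \<omega> \<Phi> y)) differentiable at z" if "z \<in> U" for z
    using constraint_matrix_differentiable[OF assms(1,2) that assms(3)] by (rule differentiable_det)
  then have "continuous_on U (\<lambda>y. det (constraint_matrix \<omega> \<Phi> y))"
    by (simp add: continuous_at_imp_continuous_on differentiable_imp_continuous_within)
  from continuous_open_preimage[OF this \<open>open U\<close>, of "- {0}"]
  have "open (U \<inter> (\<lambda>y. det (constraint_matrix \<omega> \<Phi> y)) -` (- {0}))" by auto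
  also have "U \<inter> (\<lambda>y. det (constraint_matrix \<omega> \<Phi> y)) -` (- {0}) = dirac_domain U \<omega> \<Phi>"
    by (auto simp: dirac_domain_def)
  finally show ?thesis .
qed

text \<open>The three vanishing conditions act in two places: \<open>B0\<close> and
  \<open>C0\<close> make the correction term of the inner bracket flat at \<open>z\<close>, and
  \<open>A0\<close> removes the correction term of the outer bracket.\<close>

lemma dirac_bracket_nested_eq_poisson:
  assumes \<omega>: "poisson_tensor_on U \<omega>" "open U" and \<Phi>: "\<And>a. smooth_fun_on U (\<Phi> a)"
    and W: "open W" "W \<subseteq> dirac_domain U \<omega> \<Phi>" "z \<in> W"
    and B: "smooth_fun_on W B" and C: "smooth_fun_on W C"
    and A0: "\<And>a. poisson_bracket \<omega> A (\<Phi> a) z = 0"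
    and B0: "\<And>a. poisson_bracket \<omega> B (\<Phi> a) z = 0"
    and C0: "\<And>a. poisson_bracket \<omega> C (\<Phi> a) z = 0"
  shows "dirac_bracket \<omega> \<Phi> A (dirac_bracket \<omega> \<Phi> B C) z = poisson_bracket \<omega> A (poisson_bracket \<omega> B C) z"
proof -
  have "z \<in> U" using W by (auto simp: dirac_domain_def)
  have d: "partial_deriv i f differentiable at z" if "smooth_fun_on W f" for i f
    using that W by (blast intro: smooth_fun_on_differentiable smooth_fun_on_partial_deriv)
  have "W \<subseteq> U" using W by (auto simp: dirac_domain_def)
  then have \<Phi>W: "smooth_fun_on W (\<Phi> a)" for a
    using \<Phi> smooth_fun_on_subset by blast
  note dp = differentiable_poisson_bracket[OF poisson_tensor_on_differentiable[OF \<omega> \<open>z \<in> U\<close>] d d]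
  let ?D = "\<lambda>y. matrix_inv (constraint_matrix \<omega> \<Phi> y)"
  have D: "(\<lambda>y. ?D y $ a $ b) differentiable at z" for a b
    using W constraint_matrix_differentiable[OF \<omega> \<open>z \<in> U\<close> \<Phi>]
    by (intro differentiable_matrix_inv_nth[of W]) (auto simp: dirac_domain_def)
  let ?t = "\<lambda>a b y. poisson_bracket \<omega> B (\<Phi> a) y * ?D y $ a $ b * poisson_bracket \<omega> (\<Phi> b) C y"
  have C0': "poisson_bracket \<omega> (\<Phi> b) C z = 0" for b
    using poisson_bracket_skew[OF \<omega>(1) \<open>z \<in> U\<close>, of "\<Phi> b" C] C0 by simp
  have t: "?t a b differentiable at z" for a b
    by (intro differentiable_mult dp D B C \<Phi>W)
  \<comment> \<open>The product rule differentiates one of three factors, so in each summand at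
    least one of the two factors vanishing at \<open>z\<close> survives. The derivative of the
    inverse matrix occurs only multiplied by both.\<close>
  have t': "partial_deriv p (?t a b) z = 0" for p a b
    by (subst partial_deriv_mult3[OF dp[OF B \<Phi>W] D dp[OF \<Phi>W C]]) (simp add: B0 C0')
  have s: "(\<lambda>y. \<Sum>b\<in>UNIV. ?t a b y) differentiable at z" for a
    using t by simp
  then have ss: "(\<lambda>y. \<Sum>a\<in>UNIV. \<Sum>b\<in>UNIV. ?t a b y) differentiable at z"
    by simp
  have "partial_deriv p (\<lambda>y. \<Sum>a\<in>UNIV. \<Sum>b\<in>UNIV. ?t a b y) z = 0" for p
    using partial_deriv_sum[of UNIV "\<lambda>a y. \<Sum>b\<in>UNIV. ?t a b y" z p] s
      partial_deriv_sum[of UNIV "?t _" z p] t t' by simp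
  then have "partial_deriv p (dirac_bracket \<omega> \<Phi> B C) z = partial_deriv p (poisson_bracket \<omega> B C) z" for p
    using partial_deriv_diff[OF dp[OF B C] ss, of p] by (simp add: dirac_bracket_def[abs_def])
  then have "poisson_bracket \<omega> A (dirac_bracket \<omega> \<Phi> B C) z = poisson_bracket \<omega> A (poisson_bracket \<omega> B C) z"
    by (rule poisson_bracket_cong_right)
  then show ?thesis
    by (simp add: dirac_bracket_def[of \<omega> \<Phi> A] A0)
qed

lemma dirac_bracket_jacobi:
  assumes \<omega>: "poisson_tensor_on U \<omega>" "open U" and \<Phi>: "\<And>a. smooth_fun_on U (\<Phi> a)"
    and W: "open W" "W \<subseteq> dirac_domain U \<omega> \<Phi>" "z \<in> W"
    and A: "smooth_fun_on W A" and B: "smooth_fun_on W B" and C: "smooth_fun_on W C"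
  shows "dirac_bracket \<omega> \<Phi> A (dirac_bracket \<omega> \<Phi> B C) z +
    dirac_bracket \<omega> \<Phi> B (dirac_bracket \<omega> \<Phi> C A) z +
    dirac_bracket \<omega> \<Phi> C (dirac_bracket \<omega> \<Phi> A B) z = 0"
proof -
  have U: "W \<subseteq> U" and det: "\<And>y. y \<in> W \<Longrightarrow> det (constraint_matrix \<omega> \<Phi> y) \<noteq> 0"
    using W by (auto simp: dirac_domain_def)
  have \<Phi>W: "smooth_fun_on W (\<Phi> a)" for a
    using \<Phi> U smooth_fun_on_subset by blast
  have diff: "f differentiable at y" if "smooth_fun_on W f" "y \<in> W" for f y
    using that W by (blast intro: smooth_fun_on_differentiable)
  define sh where "sh f c = (\<lambda>y. f y - (\<Sum>a\<in>UNIV. c a * \<Phi> a y))" for f c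
  have "\<exists>c. \<forall>b. poisson_bracket \<omega> (sh f c) (\<Phi> b) z = 0" if "smooth_fun_on W f" for f
    unfolding sh_def using W(3) that \<Phi>W
    by (intro exists_shift_commuting_with_constraints det diff)
  with A B C obtain a b c where c:
    "\<And>i. poisson_bracket \<omega> (sh A a) (\<Phi> i) z = 0"
    "\<And>i. poisson_bracket \<omega> (sh B b) (\<Phi> i) z = 0"
    "\<And>i. poisson_bracket \<omega> (sh C c) (\<Phi> i) z = 0"
    by meson
  have smooth: "smooth_fun_on W (sh f c)" if "smooth_fun_on W f" for f c
    unfolding sh_def using W(1) that \<Phi>W by (intro smooth_fun_on_diff_sum) auto
  have eq: "dirac_bracket \<omega> \<Phi> (sh f c) (dirac_bracket \<omega> \<Phi> (sh g d) (sh h e)) z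
      = dirac_bracket \<omega> \<Phi> f (dirac_bracket \<omega> \<Phi> g h) z"
    if "smooth_fun_on W f" "smooth_fun_on W g" "smooth_fun_on W h" for f g h c d e
  proof -
    \<comment> \<open>Equality is needed on all of \<open>W\<close>, since the outer bracket
      differentiates the inner one. The coefficients \<open>d\<close> and \<open>e\<close> are fixed
      here while \<open>y\<close> varies; the Casimir property at \<open>y\<close> absorbs them
      whatever their values.\<close>
    have "dirac_bracket \<omega> \<Phi> (sh g d) (sh h e) y = dirac_bracket \<omega> \<Phi> g h y" if "y \<in> W" for y
    proof -
      have "dirac_bracket \<omega> \<Phi> (sh g d) (sh h e) y = dirac_bracket \<omega> \<Phi> g (sh h e) y"
        unfolding sh_def[of g]
        by (intro dirac_bracket_shift_left det diff that \<Phi>W \<open>smooth_fun_on W g\<close>)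
      also have "\<dots> = dirac_bracket \<omega> \<Phi> g h y"
        unfolding sh_def using U that
        by (intro dirac_bracket_shift_right[OF \<omega>(1)] det diff \<Phi>W \<open>smooth_fun_on W h\<close>) auto
      finally show ?thesis .
    qed
    then have "dirac_bracket \<omega> \<Phi> (sh f c) (dirac_bracket \<omega> \<Phi> (sh g d) (sh h e)) z
      = dirac_bracket \<omega> \<Phi> (sh f c) (dirac_bracket \<omega> \<Phi> g h) z"
      by (intro dirac_bracket_cong_right partial_deriv_cong_open[OF W(1,3)])
    also have "\<dots> = dirac_bracket \<omega> \<Phi> f (dirac_bracket \<omega> \<Phi> g h) z"
      unfolding sh_def by (intro dirac_bracket_shift_left det diff \<Phi>W W(3) that)
    finally show ?thesis .
  qed
  note nested = dirac_bracket_nested_eq_poisson[OF \<omega> \<Phi> W]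
  \<comment> \<open>In each cyclic term the vanishing conditions are supplied in the order outer
    function, then the two inner ones, hence the rotations of \<open>c\<close>.\<close>
  have "dirac_bracket \<omega> \<Phi> (sh A a) (dirac_bracket \<omega> \<Phi> (sh B b) (sh C c)) z +
    dirac_bracket \<omega> \<Phi> (sh B b) (dirac_bracket \<omega> \<Phi> (sh C c) (sh A a)) z +
    dirac_bracket \<omega> \<Phi> (sh C c) (dirac_bracket \<omega> \<Phi> (sh A a) (sh B b)) z = 0"
    using poisson_bracket_jacobi[OF \<omega> W(1) U W(3) smooth[OF A] smooth[OF B] smooth[OF C], of a b c]
      nested[OF smooth[OF B] smooth[OF C] c] nested[OF smooth[OF C] smooth[OF A] c(2,3,1)]
      nested[OF smooth[OF A] smooth[OF B] c(3,1,2)]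
    by simp
  then show ?thesis by (simp add: eq A B C)
qed

text \<open>The neighbourhood of the constraint surface is the whole set
  \<open>dirac_domain U \<omega> \<Phi>\<close>. The functions need only be given on some open part
  \<open>W\<close> of it, which expresses the local nature of the claim.\<close>

theorem mainTheorem5:
  fixes U :: "(real ^ 'i::finite) set"
    and \<omega> :: "real ^ 'i \<Rightarrow> real ^ 'i ^ 'i"
    and \<Phi> :: "'a::finite \<Rightarrow> real ^ 'i \<Rightarrow> real"
    and m n :: nat
  assumes "open U"
    and "poisson_tensor_on U \<omega>"
    and "degenerate_on U \<omega>"
    and "CARD('i) = m + n"
    and "\<forall>z\<in>U. rank (\<omega> z) = n"
    and "CARD('a) < n"
    and "\<forall>\<alpha>. smooth_fun_on U (\<Phi> \<alpha>)"
    and "functionally_independent_on U \<Phi>"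
    and "\<forall>z\<in>constraint_surface U \<Phi>. det (constraint_matrix \<omega> \<Phi> z) \<noteq> 0"
  shows "open (dirac_domain U \<omega> \<Phi>) \<and>
    constraint_surface U \<Phi> \<subseteq> dirac_domain U \<omega> \<Phi> \<and>
    (\<forall>W A B C. open W \<longrightarrow> W \<subseteq> dirac_domain U \<omega> \<Phi> \<longrightarrow>
       smooth_fun_on W A \<longrightarrow> smooth_fun_on W B \<longrightarrow> smooth_fun_on W C \<longrightarrow>
       (\<forall>z\<in>W.
          dirac_bracket \<omega> \<Phi> A (dirac_bracket \<omega> \<Phi> B C) z +
          dirac_bracket \<omega> \<Phi> B (dirac_bracket \<omega> \<Phi> C A) z +
          dirac_bracket \<omega> \<Phi> C (dirac_bracket \<omega> \<Phi> A B) z = 0))"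
proof (intro conjI allI impI ballI)
  show "open (dirac_domain U \<omega> \<Phi>)"
    using assms by (intro open_dirac_domain) auto
  show "constraint_surface U \<Phi> \<subseteq> dirac_domain U \<omega> \<Phi>"
    using assms by (auto simp: constraint_surface_def dirac_domain_def)
next
  fix W A B C z
  assume "open W" "W \<subseteq> dirac_domain U \<omega> \<Phi>" "smooth_fun_on W A" "smooth_fun_on W B"
    "smooth_fun_on W C" "z \<in> W"
  then show "dirac_bracket \<omega> \<Phi> A (dirac_bracket \<omega> \<Phi> B C) z +
      dirac_bracket \<omega> \<Phi> B (dirac_bracket \<omega> \<Phi> C A) z +
      dirac_bracket \<omega> \<Phi> C (dirac_bracket \<omega> \<Phi> A B) z = 0"
    using assms by (intro dirac_bracket_jacobi[of U]) auto
qed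

end
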